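(* Let $S$ be a real $n\times n$ matrix with $\operatorname{rank}(S)=n-1$, $S\mathbf{1}=0$ and $S'\mathbf{1}=0$, and let $\gamma$ be the common value of the cofactors of $S$. Define $D=\operatorname{diag}(S)J+J\operatorname{diag}(S)-2S$. Let $\Omega_1,\Omega_2\subseteq\{1,\dots,n\}$ be non-empty with $\eta:=|\Omega_1|=|\Omega_2|$. Then \[\operatorname{cofsum}(D[\Omega_1,\Omega_2])=(-1)^{\alpha(\Omega_1)+\alpha(\Omega_2)+\eta-1}\,2^{\eta-1}n^2\gamma\,\det\big(S^\dagger[\Omega_2^c,\Omega_1^c]\big).\]
   Context: $\mathbf{1}$ is the all-ones vector in $\mathbb{R}^n$, $J=\mathbf{1}\mathbf{1}'$, and $\operatorname{diag}(S)$ is the diagonal matrix with the diagonal entries of $S$; under the hypotheses all cofactors of $S$ are equal. $S^\dagger$ is the Moore–Penrose inverse. $W[\Omega_1,\Omega_2]$ is the submatrix with rows indexed by $\Omega_1$ and columns by $\Omega_2$; $\Omega^c$ is the complement in $\{1,\dots,n\}$; $\alpha(\Omega)$ is the sum of the elements of $\Omega$. $\operatorname{cofsum}(B)=\mathbf{1}'\operatorname{adj}(B)\mathbf{1}$ is the sum of all cofactors of $B$. The determinant of a $0\times0$ matrix is $1$. *)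

theory Defs
  imports
    "Jordan_Normal_Form.Determinant"
    "Jordan_Normal_Form.DL_Rank"
    "Jordan_Normal_Form.DL_Submatrix"
begin

definition ones_vec :: "nat \<Rightarrow> real vec" where
  "ones_vec n = vec n (\<lambda>_. 1)"

definition ones_mat :: "nat \<Rightarrow> real mat" where
  "ones_mat n = mat n n (\<lambda>_. 1)"

definition diag_part :: "real mat \<Rightarrow> real mat" where
  "diag_part S = mat_diag (dim_row S) (\<lambda>i. S $$ (i, i))"

definition is_moore_penrose :: "real mat \<Rightarrow> real mat \<Rightarrow> bool" where
  "is_moore_penrose A X \<longleftrightarrow>
     X \<in> carrier_mat (dim_col A) (dim_row A) \<and>
     A * X * A = A \<and>
     X * A * X = X \<and>
     (A * X)\<^sup>T = A * X \<and>
     (X * A)\<^sup>T = X * A"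

definition moore_penrose :: "real mat \<Rightarrow> real mat" where
  "moore_penrose A = (THE X. is_moore_penrose A X)"

text \<open>The value is meaningful only when all cofactors of the matrix agree.\<close>

definition common_cofactor :: "real mat \<Rightarrow> real" where
  "common_cofactor S =
     (THE g. \<forall>i<dim_row S. \<forall>j<dim_col S. cofactor S i j = g)"

definition cofsum :: "real mat \<Rightarrow> real" where
  "cofsum B = ones_vec (dim_row B) \<bullet> (adj_mat B *\<^sub>v ones_vec (dim_col B))"

text \<open>Index sets are subsets of \<open>{1..n}\<close>, whereas matrix entries are indexed from \<open>0\<close>:
  the mathematical index \<open>k\<close> is row or column \<open>k - 1\<close>.\<close>

definition submat :: "real mat \<Rightarrow> nat set \<Rightarrow> nat set \<Rightarrow> real mat" where
  "submat W \<Omega>1 \<Omega>2 = submatrix W {i. Suc i \<in> \<Omega>1} {j. Suc j \<in> \<Omega>2}"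

definition index_sum :: "nat set \<Rightarrow> nat" where
  "index_sum \<Omega> = \<Sum>\<Omega>"

end

theory Submission
  imports Defs
begin

text \<open>
  The cofactor sum is the slope of \<open>t \<mapsto> det (A + t J)\<close>; it does not change when a vector is added to
  all columns or to all rows of \<open>A\<close>. Hence the diagonal terms of \<open>D\<close> can be dropped and
  \<open>cofsum (D[\<Omega>1, \<Omega>2]) = (-2)^(\<eta> - 1) cofsum (S[\<Omega>1, \<Omega>2])\<close>. For \<open>t \<noteq> 0\<close> the matrix \<open>S + t J\<close> has
  determinant \<open>t n\<^sup>2 \<gamma>\<close> and inverse \<open>S\<^sup>\<dagger> + J / (n\<^sup>2 t)\<close>. In Jacobi's complementary minor identity for this
  pair both sides are affine in \<open>t\<close>, and comparing slopes gives the theorem.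
\<close>

section \<open>Rank-one perturbations of a determinant\<close>

lemma det_add_rank_one:
  fixes A :: "'a :: idom mat"
  assumes A: "A \<in> carrier_mat n n"
  shows "det (mat n n (\<lambda>(i, j). A $$ (i, j) + u i * v j)) =
    det A + (\<Sum>i<n. u i * (\<Sum>j<n. v j * cofactor A i j))"
proof -
  \<comment> \<open>\<open>M k\<close> carries the perturbation in its first \<open>k\<close> rows only; adding one more row changes the
    determinant by a term from which the earlier perturbations can be eliminated by row operations.\<close>
  define M where "M k = mat n n (\<lambda>(i, j). A $$ (i, j) + (if i < k then u i * v j else 0))" for k
  have M: "M k \<in> carrier_mat n n" for k unfolding M_def by simp
  have main: "det (M k) = det A + (\<Sum>i<k. u i * (\<Sum>j<n. v j * cofactor A i j))" if "k \<le> n" for k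
    using that
  proof (induction k)
    case 0
    have "M 0 = A" unfolding M_def using A by (intro eq_matI) auto
    then show ?case by simp
  next
    case (Suc k)
    then have k: "k < n" by simp
    \<comment> \<open>\<open>R B\<close> is \<open>B\<close> with row \<open>k\<close> replaced by
      \<open>v\<close>. The determinant of \<open>R (M k)\<close> is the coefficient of
      \<open>u k\<close> in the passage from \<open>M k\<close> to \<open>M (Suc k)\<close>.\<close>
    define R where "R B = mat n n (\<lambda>(i, j). if i = k then v j else B $$ (i, j))" for B :: "'a mat"
    have R: "R B \<in> carrier_mat n n" for B unfolding R_def by simp
    have cofR: "cofactor (R B) k j = cofactor B k j" if "B \<in> carrier_mat n n" "j < n" for B j
    proof -
      have "mat_delete (R B) k j = mat_delete B k j"
        unfolding mat_delete_def R_def using that k by (intro eq_matI) auto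
      then show ?thesis unfolding cofactor_def by simp
    qed
    have detR: "det (R B) = (\<Sum>j<n. v j * cofactor B k j)" if B: "B \<in> carrier_mat n n" for B
    proof -
      have "det (R B) = (\<Sum>j<n. R B $$ (k, j) * cofactor (R B) k j)"
        by (rule laplace_expansion_row[OF R k])
      also have "\<dots> = (\<Sum>j<n. v j * cofactor B k j)"
      proof (intro sum.cong refl arg_cong2[of _ _ _ _ "(*)"])
        fix j assume "j \<in> {..<n}"
        then show "R B $$ (k, j) = v j" "cofactor (R B) k j = cofactor B k j"
          using k cofR[OF B] by (simp_all add: R_def)
      qed
      finally show ?thesis .
    qed
    have cofM: "cofactor (M (Suc k)) k j = cofactor (M k) k j" if "j < n" for j
    proof -
      have "mat_delete (M (Suc k)) k j = mat_delete (M k) k j"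
        unfolding mat_delete_def M_def using that k by (intro eq_matI) auto
      then show ?thesis unfolding cofactor_def by simp
    qed
    \<comment> \<open>\<open>L\<close> adds \<open>u i\<close> times row \<open>k\<close> to each
      row \<open>i < k\<close>. Row \<open>k\<close> of \<open>R A\<close> is \<open>v\<close>, so
      this produces precisely the earlier perturbations, and \<open>L\<close> is
      unitriangular.\<close>
    define L where "L = mat n n (\<lambda>(i, j). if i = j then 1 else if j = k \<and> i < k then u i else 0)"
    have L: "L \<in> carrier_mat n n" unfolding L_def by simp
    have "R (M k) = L * R A"
    proof (rule eq_matI)
      fix i j assume "i < dim_row (L * R A)" "j < dim_col (L * R A)"
      then have ij: "i < n" "j < n" using L R[of A] by auto
      have "(L * R A) $$ (i, j) = (\<Sum>l<n. L $$ (i, l) * R A $$ (l, j))"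
        using ij L R[of A] by (simp add: scalar_prod_def lessThan_atLeast0)
      also have "\<dots> = (\<Sum>l<n. (if l = i then R A $$ (i, j) else 0) +
          (if l = k then (if i < k then u i * v j else 0) else 0))"
        by (intro sum.cong refl) (use ij k in \<open>auto simp: L_def R_def\<close>)
      also have "\<dots> = R A $$ (i, j) + (if i < k then u i * v j else 0)"
        using ij k by (simp add: sum.distrib)
      also have "\<dots> = R (M k) $$ (i, j)"
        using ij k by (auto simp: R_def M_def)
      finally show "R (M k) $$ (i, j) = (L * R A) $$ (i, j)" by simp
    qed (use L R[of A] R[of "M k"] in auto)
    moreover have "det L = 1"
    proof -
      have "upper_triangular L" by (rule upper_triangularI) (auto simp: L_def)
      from det_upper_triangular[OF this L] show ?thesis
        by (simp add: prod_list_diag_prod L_def)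
    qed
    ultimately have RM: "det (R (M k)) = det (R A)" using det_mult[OF L R] by simp
    have "det (M (Suc k)) = (\<Sum>j<n. M (Suc k) $$ (k, j) * cofactor (M (Suc k)) k j)"
      by (rule laplace_expansion_row[OF M k])
    also have "\<dots> = (\<Sum>j<n. M k $$ (k, j) * cofactor (M k) k j + u k * (v j * cofactor (M k) k j))"
    proof (intro sum.cong refl)
      fix j assume "j \<in> {..<n}"
      then have "M (Suc k) $$ (k, j) = M k $$ (k, j) + u k * v j"
        "cofactor (M (Suc k)) k j = cofactor (M k) k j"
        using k cofM by (simp_all add: M_def)
      then show "M (Suc k) $$ (k, j) * cofactor (M (Suc k)) k j =
          M k $$ (k, j) * cofactor (M k) k j + u k * (v j * cofactor (M k) k j)"
        by (simp add: algebra_simps)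
    qed
    also have "\<dots> = det (M k) + u k * det (R (M k))"
      by (simp add: sum.distrib laplace_expansion_row[OF M k] detR[OF M] sum_distrib_left)
    also have "\<dots> = det (M k) + u k * (\<Sum>j<n. v j * cofactor A k j)"
      by (simp add: RM detR[OF A])
    finally show ?case using Suc by (simp add: add.assoc)
  qed
  have "M n = mat n n (\<lambda>(i, j). A $$ (i, j) + u i * v j)"
    unfolding M_def by (intro eq_matI) auto
  then show ?thesis using main[of n] by simp
qed

section \<open>The cofactor sum and its invariances\<close>

lemma cofsum_eq_sum_cofactor:
  assumes "A \<in> carrier_mat n n"
  shows "cofsum A = (\<Sum>i<n. \<Sum>j<n. cofactor A i j)"
proof -
  have "cofsum A = (\<Sum>j<n. \<Sum>i<n. cofactor A i j)"
    using assms unfolding cofsum_def ones_vec_def adj_mat_def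
    by (simp add: scalar_prod_def lessThan_atLeast0)
  then show ?thesis using sum.swap by metis
qed

lemma det_add_const:
  assumes "A \<in> carrier_mat n n"
  shows "det (mat n n (\<lambda>(i, j). A $$ (i, j) + t)) = det A + t * cofsum A"
  using det_add_rank_one[OF assms, of "\<lambda>_. t" "\<lambda>_. 1"]
  by (simp add: cofsum_eq_sum_cofactor[OF assms] sum_distrib_left)

text \<open>Adding 1 to every entry of the perturbed matrix merges with the perturbation into the
  single rank-one term \<open>(u i + 1) * 1\<close>. The rank-one formula is affine in
  \<open>u\<close>, so this raises the determinant by \<open>cofsum A\<close> whatever
  \<open>u\<close> is; that increment is also the cofactor sum of the perturbed matrix.\<close>

lemma cofsum_add_row_const:
  assumes A: "A \<in> carrier_mat n n"
  shows "cofsum (mat n n (\<lambda>(i, j). A $$ (i, j) + u i)) = cofsum A"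
proof -
  let ?B = "mat n n (\<lambda>(i, j). A $$ (i, j) + u i)"
  have "det ?B + cofsum ?B = det (mat n n (\<lambda>(i, j). ?B $$ (i, j) + 1))"
    using det_add_const[of ?B n 1] by simp
  also have "\<dots> = det (mat n n (\<lambda>(i, j). A $$ (i, j) + (u i + 1) * 1))"
    by (intro arg_cong[of _ _ det] eq_matI) auto
  also have "\<dots> = det A + (\<Sum>i<n. u i * (\<Sum>j<n. cofactor A i j)) + cofsum A"
    unfolding det_add_rank_one[OF A]
    by (simp add: cofsum_eq_sum_cofactor[OF A] distrib_right sum.distrib)
  finally show ?thesis using det_add_rank_one[OF A, of u "\<lambda>_. 1"] by simp
qed

text \<open>The same comparison, with the rank-one term \<open>1 * (v j + 1)\<close>.\<close>

lemma cofsum_add_col_const: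
  assumes A: "A \<in> carrier_mat n n"
  shows "cofsum (mat n n (\<lambda>(i, j). A $$ (i, j) + v j)) = cofsum A"
proof -
  let ?B = "mat n n (\<lambda>(i, j). A $$ (i, j) + v j)"
  have "det ?B + cofsum ?B = det (mat n n (\<lambda>(i, j). ?B $$ (i, j) + 1))"
    using det_add_const[of ?B n 1] by simp
  also have "\<dots> = det (mat n n (\<lambda>(i, j). A $$ (i, j) + 1 * (v j + 1)))"
    by (intro arg_cong[of _ _ det] eq_matI) auto
  also have "\<dots> = det A + (\<Sum>i<n. \<Sum>j<n. v j * cofactor A i j) + cofsum A"
    unfolding det_add_rank_one[OF A]
    by (simp add: cofsum_eq_sum_cofactor[OF A] distrib_right sum.distrib)
  finally show ?thesis using det_add_rank_one[OF A, of "\<lambda>_. 1" v] by simp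
qed

text \<open>Up to sign, each cofactor is a minor of order \<open>n - 1\<close>. For
  \<open>n = 0\<close> the truncated exponent is harmless, since both cofactor sums are
  empty.\<close>

lemma cofsum_smult:
  assumes A: "A \<in> carrier_mat n n"
  shows "cofsum (c \<cdot>\<^sub>m A) = c ^ (n - 1) * cofsum A"
proof -
  have "cofactor (c \<cdot>\<^sub>m A) i j = c ^ (n - 1) * cofactor A i j" if "i < n" "j < n" for i j
  proof -
    have "mat_delete (c \<cdot>\<^sub>m A) i j = c \<cdot>\<^sub>m mat_delete A i j"
      unfolding mat_delete_def using A that by (intro eq_matI) auto
    then show ?thesis unfolding cofactor_def using A by simp
  qed
  then show ?thesis
    using A by (simp add: cofsum_eq_sum_cofactor[of _ n] sum_distrib_left)
qed

section \<open>Reordered minors and the signs of permutation matrices\<close>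

text \<open>Indices are ordered lists instead of sets: permuting rows or columns is then a change of
  list, and concatenated lists yield a block partition.\<close>

definition select_mat :: "'a mat \<Rightarrow> nat list \<Rightarrow> nat list \<Rightarrow> 'a mat" where
  "select_mat A xs ys = mat (length xs) (length ys) (\<lambda>(i, j). A $$ (xs ! i, ys ! j))"

text \<open>Row \<open>i\<close> is the unit vector with its 1 at position \<open>xs ! i\<close>;
  the matrix is a permutation matrix when \<open>xs\<close> enumerates \<open>{..<length xs}\<close>
  without repetition.\<close>

definition list_perm_mat :: "nat list \<Rightarrow> 'a :: idom mat" where
  "list_perm_mat xs = mat (length xs) (length xs) (\<lambda>(i, j). if xs ! i = j then 1 else 0)"

lemma nth_less_if_set_subset: "set xs \<subseteq> {..<n} \<Longrightarrow> i < length xs \<Longrightarrow> xs ! i < n"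
  using nth_mem[of i xs] by blast

text \<open>Unit-vector rows on the left pick rows of \<open>A\<close>; the transpose on the right
  picks columns.\<close>

lemma select_mat_eq_perm_mult:
  fixes A :: "'a :: idom mat"
  assumes A: "A \<in> carrier_mat n n"
    and xs: "set xs \<subseteq> {..<n}" "length xs = n" and ys: "set ys \<subseteq> {..<n}" "length ys = n"
  shows "select_mat A xs ys = list_perm_mat xs * A * (list_perm_mat ys)\<^sup>T"
proof (rule eq_matI)
  fix i j assume "i < dim_row (list_perm_mat xs * A * (list_perm_mat ys)\<^sup>T)"
    "j < dim_col (list_perm_mat xs * A * (list_perm_mat ys)\<^sup>T)"
  then have ij: "i < n" "j < n" using xs ys by (auto simp: list_perm_mat_def)
  have lt: "xs ! i < n" "ys ! j < n" using ij xs ys nth_less_if_set_subset[of xs n i] nth_less_if_set_subset[of ys n j] by auto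
  have left: "(list_perm_mat xs * A) $$ (i, l) = A $$ (xs ! i, l)" if "l < n" for l
  proof -
    have "(list_perm_mat xs * A) $$ (i, l) = (\<Sum>m<n. list_perm_mat xs $$ (i, m) * A $$ (m, l))"
      using ij that A xs by (simp add: scalar_prod_def lessThan_atLeast0 list_perm_mat_def)
    also have "\<dots> = (\<Sum>m<n. if m = xs ! i then A $$ (m, l) else 0)"
      by (intro sum.cong refl) (use ij xs in \<open>auto simp: list_perm_mat_def\<close>)
    finally show ?thesis using lt by simp
  qed
  have "(list_perm_mat xs * A * (list_perm_mat ys)\<^sup>T) $$ (i, j) =
      (\<Sum>l<n. (list_perm_mat xs * A) $$ (i, l) * (list_perm_mat ys) $$ (j, l))"
    using ij A xs ys by (simp add: scalar_prod_def lessThan_atLeast0 list_perm_mat_def)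
  also have "\<dots> = (\<Sum>l<n. if l = ys ! j then A $$ (xs ! i, l) else 0)"
  proof (intro sum.cong refl)
    fix l assume "l \<in> {..<n}"
    then have "list_perm_mat ys $$ (j, l) = (if l = ys ! j then 1 else 0 :: 'a)"
      using ij ys by (auto simp: list_perm_mat_def)
    then show "(list_perm_mat xs * A) $$ (i, l) * list_perm_mat ys $$ (j, l) =
        (if l = ys ! j then A $$ (xs ! i, l) else 0)"
      using \<open>l \<in> {..<n}\<close> left by simp
  qed
  finally show "select_mat A xs ys $$ (i, j) = (list_perm_mat xs * A * (list_perm_mat ys)\<^sup>T) $$ (i, j)"
    using lt ij xs ys by (simp add: select_mat_def)
qed (use xs ys in \<open>auto simp: select_mat_def list_perm_mat_def\<close>)

lemma det_select_mat_perm: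
  fixes A :: "'a :: idom mat"
  assumes A: "A \<in> carrier_mat n n"
    and xs: "set xs \<subseteq> {..<n}" "length xs = n" and ys: "set ys \<subseteq> {..<n}" "length ys = n"
  shows "det (select_mat A xs ys) = det (list_perm_mat xs) * det (list_perm_mat ys) * det A"
proof -
  have P: "(list_perm_mat xs :: 'a mat) \<in> carrier_mat n n" "(list_perm_mat ys :: 'a mat) \<in> carrier_mat n n"
    using xs ys by (auto simp: list_perm_mat_def)
  show ?thesis
    unfolding select_mat_eq_perm_mult[OF assms]
    using det_mult[OF mult_carrier_mat[OF P(1) A] transpose_carrier_mat[THEN iffD2, OF P(2)]]
      det_mult[OF P(1) A] det_transpose[OF P(2)] by simp
qed

text \<open>The value \<open>n\<close> occurs only at position \<open>length xs\<close>, so the last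
  column has one nonzero entry and the Laplace expansion along it reduces to one term.\<close>

lemma det_list_perm_mat_insert:
  assumes len: "length xs + length ys = n" and "set xs \<subseteq> {..<n}" "set ys \<subseteq> {..<n}"
  shows "det (list_perm_mat (xs @ n # ys) :: 'a :: idom mat) =
    (-1) ^ (length xs + n) * det (list_perm_mat (xs @ ys) :: 'a mat)"
proof -
  let ?P = "list_perm_mat (xs @ n # ys) :: 'a mat"
  have P: "?P \<in> carrier_mat (Suc n) (Suc n)" using len by (auto simp: list_perm_mat_def)
  have entry: "?P $$ (i, n) = (if i = length xs then 1 else 0)" if "i < Suc n" for i
  proof -
    have "i < length xs \<Longrightarrow> xs ! i \<noteq> n" "l < length ys \<Longrightarrow> ys ! l \<noteq> n" for l
      using assms nth_less_if_set_subset[of xs n i] nth_less_if_set_subset[of ys n l] by auto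
    then show ?thesis using that len
      by (auto simp: list_perm_mat_def nth_append nth_Cons split: nat.splits)
  qed
  have "det ?P = (\<Sum>i<Suc n. ?P $$ (i, n) * cofactor ?P i n)"
    by (rule laplace_expansion_column[OF P]) simp
  also have "\<dots> = (\<Sum>i<Suc n. if i = length xs then cofactor ?P i n else 0)"
    by (intro sum.cong refl) (auto simp: entry)
  also have "\<dots> = cofactor ?P (length xs) n" using len by simp
  also have "mat_delete ?P (length xs) n = list_perm_mat (xs @ ys)"
    using len
    by (intro eq_matI) (auto simp: mat_delete_def list_perm_mat_def nth_append Suc_diff_le)
  then have "cofactor ?P (length xs) n = (-1) ^ (length xs + n) * det (list_perm_mat (xs @ ys))"
    by (simp add: cofactor_def)
  finally show ?thesis .
qed

lemma sorted_list_of_set_insert_greater: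
  assumes "finite I" "\<And>i. i \<in> I \<Longrightarrow> i < (n :: nat)"
  shows "sorted_list_of_set (insert n I) = sorted_list_of_set I @ [n]"
proof (rule sorted_distinct_set_unique)
  show "sorted (sorted_list_of_set I @ [n])" "distinct (sorted_list_of_set I @ [n])"
    using assms by (force simp: sorted_append)+
qed (use assms in \<open>auto simp del: sorted_list_of_set_insert_remove\<close>)

definition complement_last_list :: "nat \<Rightarrow> nat set \<Rightarrow> nat list" where
  "complement_last_list n I = sorted_list_of_set I @ sorted_list_of_set ({..<n} - I)"

lemma complement_last_list_props:
  assumes "I \<subseteq> {..<n}"
  shows "set (complement_last_list n I) = {..<n}" "length (complement_last_list n I) = n" "distinct (complement_last_list n I)"
proof -
  have I: "finite I" using assms finite_subset by blast
  show "set (complement_last_list n I) = {..<n}" "distinct (complement_last_list n I)"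
    using I assms by (auto simp: complement_last_list_def)
  show "length (complement_last_list n I) = n"
    using I assms card_mono[OF _ assms] by (simp add: complement_last_list_def card_Diff_subset)
qed

text \<open>Moving \<open>I\<close> in front of its complement takes \<open>\<Sum>I - \<Sum>{..<card I}\<close> adjacent swaps.\<close>

lemma det_list_perm_mat_complement_last_list:
  assumes "I \<subseteq> {..<n}"
  shows "det (list_perm_mat (complement_last_list n I) :: 'a :: idom mat) = (-1) ^ (\<Sum>I + \<Sum>{..<card I})"
  using assms
proof (induction n arbitrary: I)
  case 0
  then show ?case by (simp add: complement_last_list_def list_perm_mat_def)
next
  case (Suc n)
  define K where "K = I - {n}"
  have K: "K \<subseteq> {..<n}" using Suc.prems unfolding K_def by (auto simp: less_Suc_eq)
  have finK: "finite K" using K finite_subset by blast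
  let ?xs = "sorted_list_of_set K" and ?ys = "sorted_list_of_set ({..<n} - K)"
  have sets: "set ?xs \<subseteq> {..<n}" "set ?ys \<subseteq> {..<n}" using K finK by auto
  have len: "length ?xs + length ?ys = n"
    using complement_last_list_props(2)[OF K] by (simp add: complement_last_list_def)
  note IH = Suc.IH[OF K, unfolded complement_last_list_def]
  show ?case
  proof (cases "n \<in> I")
    case True
    have I: "I = insert n K" "n \<notin> K" using True by (auto simp: K_def)
    have "{..<Suc n} - I = {..<n} - K" using I by auto
    then have "complement_last_list (Suc n) I = ?xs @ n # ?ys"
      using sorted_list_of_set_insert_greater[OF finK, of n] K by (auto simp: complement_last_list_def I)
    \<comment> \<open>The insertion contributes \<open>(-1) ^ (card K + n)\<close>. This matches the
      change in the exponent: from \<open>K\<close> to \<open>I\<close> the sum of elements grows by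
      \<open>n\<close>, and the sum over \<open>{..<card I}\<close> by
      \<open>card K\<close>.\<close>
    then show ?thesis
      using det_list_perm_mat_insert[OF len sets, where ?'a = 'a] IH I finK
      by (simp add: power_add algebra_simps)
  next
    case False
    have I: "I = K" using False by (auto simp: K_def)
    have "{..<Suc n} - I = insert n ({..<n} - K)" using False I by auto
    then have "complement_last_list (Suc n) I = (?xs @ ?ys) @ n # []"
      using sorted_list_of_set_insert_greater[of "{..<n} - K" n] by (auto simp: complement_last_list_def I)
    then show ?thesis
      using det_list_perm_mat_insert[of "?xs @ ?ys" "[]" n, where ?'a = 'a] IH I len sets
      by simp
  qed
qed

text \<open>As \<open>ys\<close> enumerates all indices, it merely reorders the sum defining an
  entry of \<open>A * B\<close>; distinctness of \<open>xs\<close> preserves the pattern of the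
  identity matrix.\<close>

lemma select_mat_mult:
  fixes A B :: "'a :: idom mat"
  assumes A: "A \<in> carrier_mat n n" and B: "B \<in> carrier_mat n n" and AB: "A * B = 1\<^sub>m n"
    and xs: "set xs \<subseteq> {..<n}" "distinct xs" and ys: "set ys = {..<n}" "distinct ys"
  shows "select_mat A xs ys * select_mat B ys xs = 1\<^sub>m (length xs)"
proof (rule eq_matI)
  have leny: "length ys = n" using ys distinct_card by fastforce
  fix i j assume "i < dim_row (1\<^sub>m (length xs))" "j < dim_col (1\<^sub>m (length xs))"
  then have ij: "i < length xs" "j < length xs" by auto
  with xs have lt: "xs ! i < n" "xs ! j < n" using nth_less_if_set_subset[of xs n] by auto
  have "(select_mat A xs ys * select_mat B ys xs) $$ (i, j) =
      (\<Sum>k<length ys. A $$ (xs ! i, ys ! k) * B $$ (ys ! k, xs ! j))"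
    using ij by (simp add: scalar_prod_def select_mat_def lessThan_atLeast0)
  also have "\<dots> = (\<Sum>l<n. A $$ (xs ! i, l) * B $$ (l, xs ! j))"
    by (rule sum.reindex_bij_betw[OF bij_betw_nth]) (use ys in auto)
  also have "\<dots> = (A * B) $$ (xs ! i, xs ! j)"
    using A B lt by (simp add: scalar_prod_def lessThan_atLeast0)
  also have "\<dots> = 1\<^sub>m (length xs) $$ (i, j)"
    using lt ij xs by (simp add: AB nth_eq_iff_index_eq)
  finally show "(select_mat A xs ys * select_mat B ys xs) $$ (i, j) = 1\<^sub>m (length xs) $$ (i, j)" .
qed (auto simp: select_mat_def)

section \<open>Block inverses and Jacobi's complementary minor identity\<close>

lemma four_block_mat_inject:
  assumes "A1 \<in> carrier_mat nr1 nc1" "B1 \<in> carrier_mat nr1 nc2"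
    "C1 \<in> carrier_mat nr2 nc1" "D1 \<in> carrier_mat nr2 nc2"
    "A2 \<in> carrier_mat nr1 nc1" "B2 \<in> carrier_mat nr1 nc2"
    "C2 \<in> carrier_mat nr2 nc1" "D2 \<in> carrier_mat nr2 nc2"
    and eq: "four_block_mat A1 B1 C1 D1 = four_block_mat A2 B2 C2 D2"
  shows "A1 = A2" "B1 = B2" "C1 = C2" "D1 = D2"
proof -
  note e = arg_cong[OF eq, of "\<lambda>M. M $$ (i, j)" for i j]
  show "A1 = A2"
  proof (rule eq_matI)
    fix i j assume "i < dim_row A2" "j < dim_col A2"
    then show "A1 $$ (i, j) = A2 $$ (i, j)" using e[of i j] assms(1-8) by simp
  qed (use assms in auto)
  show "B1 = B2"
  proof (rule eq_matI)
    fix i j assume "i < dim_row B2" "j < dim_col B2"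
    then show "B1 $$ (i, j) = B2 $$ (i, j)" using e[of i "nc1 + j"] assms(1-8) by simp
  qed (use assms in auto)
  show "C1 = C2"
  proof (rule eq_matI)
    fix i j assume "i < dim_row C2" "j < dim_col C2"
    then show "C1 $$ (i, j) = C2 $$ (i, j)" using e[of "nr1 + i" j] assms(1-8) by simp
  qed (use assms in auto)
  show "D1 = D2"
  proof (rule eq_matI)
    fix i j assume "i < dim_row D2" "j < dim_col D2"
    then show "D1 $$ (i, j) = D2 $$ (i, j)" using e[of "nr1 + i" "nc1 + j"] assms(1-8) by simp
  qed (use assms in auto)
qed

text \<open>Replacing the first block column of the inverse by that of the identity gives the
  product \<open>A * [[1, B12], [0, B22]] = [[A11, 0], [A21, 1]]\<close>. The claim follows by
  taking determinants, since the second factor and the right side are block triangular.\<close>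

lemma det_block_inverse:
  fixes A11 :: "'a :: idom mat"
  assumes A: "A11 \<in> carrier_mat k k" "A12 \<in> carrier_mat k m"
      "A21 \<in> carrier_mat m k" "A22 \<in> carrier_mat m m"
    and B: "B11 \<in> carrier_mat k k" "B12 \<in> carrier_mat k m"
      "B21 \<in> carrier_mat m k" "B22 \<in> carrier_mat m m"
    and AB: "four_block_mat A11 A12 A21 A22 * four_block_mat B11 B12 B21 B22 = 1\<^sub>m (k + m)"
  shows "det (four_block_mat A11 A12 A21 A22) * det B22 = det A11"
proof -
  have "four_block_mat (A11 * B11 + A12 * B21) (A11 * B12 + A12 * B22)
      (A21 * B11 + A22 * B21) (A21 * B12 + A22 * B22) =
      four_block_mat (1\<^sub>m k) (0\<^sub>m k m) (0\<^sub>m m k) (1\<^sub>m m)"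
    using AB unfolding mult_four_block_mat[OF A B] by simp
  note inj = four_block_mat_inject[OF _ _ _ _ _ _ _ _ this, of k k m m]
  have "A11 * B12 + A12 * B22 = 0\<^sub>m k m" "A21 * B12 + A22 * B22 = 1\<^sub>m m"
    by (rule inj; use A B in simp)+
  moreover have "A11 * 1\<^sub>m k + A12 * 0\<^sub>m m k = A11" "A21 * 1\<^sub>m k + A22 * 0\<^sub>m m k = A21"
    using A by (simp_all add: right_add_zero_mat)
  ultimately have "four_block_mat A11 A12 A21 A22 * four_block_mat (1\<^sub>m k) B12 (0\<^sub>m m k) B22 =
      four_block_mat A11 (0\<^sub>m k m) A21 (1\<^sub>m m)"
    using mult_four_block_mat[OF A one_carrier_mat B(2) zero_carrier_mat B(4)] by simp
  then have "det (four_block_mat A11 A12 A21 A22) * det (four_block_mat (1\<^sub>m k) B12 (0\<^sub>m m k) B22) =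
      det (four_block_mat A11 (0\<^sub>m k m) A21 (1\<^sub>m m))"
    using A B by (metis det_mult four_block_carrier_mat one_carrier_mat)
  moreover have "det (four_block_mat (1\<^sub>m k) B12 (0\<^sub>m m k) B22) = det B22"
    by (subst det_four_block_mat_lower_left_zero[OF one_carrier_mat B(2) refl B(4)]) simp
  moreover have "det (four_block_mat A11 (0\<^sub>m k m) A21 (1\<^sub>m m)) = det A11"
    by (subst det_four_block_mat_upper_right_zero[OF A(1) refl A(3) one_carrier_mat]) simp
  ultimately show ?thesis by simp
qed

text \<open>Rows are reordered to put \<open>I\<close> first and columns to put \<open>J\<close>
  first. The wanted minor is then the upper left block of \<open>A\<close>, the complementary one is
  the lower right block of \<open>B\<close>, and the two reorderings account for the sign.\<close>

lemma jacobi_complementary_minor: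
  fixes A B :: "'a :: idom mat"
  assumes A: "A \<in> carrier_mat n n" and B: "B \<in> carrier_mat n n" and AB: "A * B = 1\<^sub>m n"
    and I: "I \<subseteq> {..<n}" and J: "J \<subseteq> {..<n}" and card: "card I = card J"
  shows "det (select_mat A (sorted_list_of_set I) (sorted_list_of_set J)) =
    (-1) ^ (\<Sum>I + \<Sum>J) * det A *
    det (select_mat B (sorted_list_of_set ({..<n} - J)) (sorted_list_of_set ({..<n} - I)))"
proof -
  define k m where "k = card I" and "m = n - k"
  let ?x1 = "sorted_list_of_set I" and ?x2 = "sorted_list_of_set ({..<n} - I)"
  let ?y1 = "sorted_list_of_set J" and ?y2 = "sorted_list_of_set ({..<n} - J)"
  let ?x = "complement_last_list n I" and ?y = "complement_last_list n J"
  have fin: "finite I" "finite J" using I J finite_subset by blast+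
  have kn: "k + m = n" unfolding m_def k_def using card_mono[OF _ I] by simp
  have len: "length ?x1 = k" "length ?y1 = k" "length ?x2 = m" "length ?y2 = m"
    using fin I J card by (auto simp: k_def m_def card_Diff_subset)
  have sel: "select_mat C (p1 @ p2) (q1 @ q2) = four_block_mat (select_mat C p1 q1) (select_mat C p1 q2)
      (select_mat C p2 q1) (select_mat C p2 q2)" for C :: "'a mat" and p1 p2 q1 q2
    by (intro eq_matI) (auto simp: select_mat_def nth_append)
  have c: "select_mat C p q \<in> carrier_mat r s" if "length p = r" "length q = s" for C :: "'a mat" and p q r s
    using that by (auto simp: select_mat_def)
  have "select_mat A ?x ?y * select_mat B ?y ?x = 1\<^sub>m (k + m)"
    using select_mat_mult[OF A B AB, of ?x ?y] complement_last_list_props[OF I] complement_last_list_props[OF J] by (simp add: kn)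
  then have "det (select_mat A ?x ?y) * det (select_mat B ?y2 ?x2) = det (select_mat A ?x1 ?y1)"
    unfolding complement_last_list_def sel by (rule det_block_inverse[rotated 8]) (intro c len)+
  moreover have "det (select_mat A ?x ?y) = (-1) ^ (\<Sum>I + \<Sum>J) * det A"
  proof -
    \<comment> \<open>Both reorderings carry the same extra exponent, the sum over
      \<open>{..<card J}\<close>, because \<open>card I = card J\<close>; the two copies
      cancel.\<close>
    have "(-1 :: 'a) ^ (a + c) * (-1) ^ (b + c) = (-1) ^ (a + b)" for a b c :: nat
      by (auto simp: minus_one_power_iff)
    then show ?thesis
      using det_select_mat_perm[OF A, of ?x ?y] complement_last_list_props[OF I] complement_last_list_props[OF J]
      by (simp only: det_list_perm_mat_complement_last_list[OF I] det_list_perm_mat_complement_last_list[OF J] card order.refl)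
  qed
  ultimately show ?thesis by simp
qed

section \<open>Submatrices over index sets as list selections\<close>

text \<open>\<open>pick\<close> is the enumeration behind \<open>submatrix\<close>. It is strictly
  increasing with values in \<open>I\<close>, so by counting it exhausts \<open>I\<close> in sorted
  order.\<close>

lemma pick_eq_sorted_list_of_set:
  assumes "finite I" "i < card I"
  shows "pick I i = sorted_list_of_set I ! i"
proof -
  have "sorted_list_of_set I = map (pick I) [0..<card I]"
  proof (rule sorted_distinct_set_unique)
    have "strict_mono_on {..<card I} (pick I)"
      by (intro strict_mono_onI) (auto intro: pick_mono_le)
    then have mono: "inj_on (pick I) {..<card I}" "mono_on {..<card I} (pick I)"
      by (auto intro: strict_mono_on_imp_inj_on strict_mono_on_imp_mono_on)
    then show "distinct (map (pick I) [0..<card I])" by (simp add: distinct_map lessThan_atLeast0)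
    show "sorted (map (pick I) [0..<card I])"
      using mono(2) by (auto simp: sorted_iff_nth_mono intro: mono_onD)
    have "pick I ` {..<card I} = I"
      using mono(1) assms(1) by (intro card_subset_eq) (auto simp: card_image intro: pick_in_set_le)
    then show "set (sorted_list_of_set I) = set (map (pick I) [0..<card I])"
      using assms by (simp add: lessThan_atLeast0)
  qed (use assms in auto)
  then show ?thesis using assms by simp
qed

lemma submatrix_eq_select_mat:
  assumes A: "A \<in> carrier_mat n n" and I: "I \<subseteq> {..<n}" and J: "J \<subseteq> {..<n}"
  shows "submatrix A I J = select_mat A (sorted_list_of_set I) (sorted_list_of_set J)"
proof -
  have fin: "finite I" "finite J" using I J finite_subset by blast+
  have "{i. i < n \<and> i \<in> I} = I" "{i. i < n \<and> i \<in> J} = J" using I J by auto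
  then show ?thesis using A fin
    by (intro eq_matI) (auto simp: submatrix_def select_mat_def pick_eq_sorted_list_of_set)
qed

section \<open>Corank one and the Moore-Penrose inverse\<close>

text \<open>A maximal independent set of columns accounts for all indices but one, \<open>j\<close>.
  A kernel vector vanishing at \<open>j\<close> is a linear relation among these independent
  columns, hence zero. This is the form in which one-dimensionality of the kernel is used.\<close>

lemma (in vec_space) kernel_zero_if_corank_one:
  assumes A: "A \<in> carrier_mat n n" and rank: "rank A = n - 1" and n: "n > 0"
  obtains j where "j < n"
    "\<And>w. w \<in> carrier_vec n \<Longrightarrow> A *\<^sub>v w = 0\<^sub>v n \<Longrightarrow> w $ j = 0 \<Longrightarrow> w = 0\<^sub>v n"
proof -
  obtain U where max: "maximal U (\<lambda>T. T \<subseteq> set (cols A) \<and> lin_indpt T)"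
    using maximal_exists[of "(\<lambda>T. T \<subseteq> set (cols A) \<and> lin_indpt T)" "card (set (cols A))" "{}"]
    by (meson List.finite_set card_mono empty_iff empty_subsetI finite_lin_indpt2 rev_finite_subset)
  then have U: "U \<subseteq> set (cols A)" "lin_indpt U" unfolding maximal_def by auto
  have finU: "finite U" using U(1) finite_subset by blast
  have Uc: "U \<subseteq> carrier_vec n" using U(1) cols_dim A by blast
  have cardU: "card U = n - 1" using rank_card_indpt[OF A max] rank by simp
  have "\<exists>i<n. col A i = u" if "u \<in> U" for u
  proof -
    have "u \<in> col A ` {0..<n}" using U(1) that A by (auto simp: cols_def)
    then show ?thesis by auto
  qed
  \<comment> \<open>\<open>U\<close> is a set of vectors and forgets positions, so \<open>f\<close>
    chooses one column index for each member, even if a column is repeated in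
    \<open>A\<close>.\<close>
  then obtain f where f: "\<And>u. u \<in> U \<Longrightarrow> f u < n \<and> col A (f u) = u" by metis
  have inj: "inj_on f U" by (intro inj_onI) (metis f)
  have fU: "f ` U \<subseteq> {..<n}" using f by auto
  have "card ({..<n} - f ` U) = 1"
    using fU finU n by (simp add: card_Diff_subset card_image[OF inj] cardU)
  then obtain j where j: "{..<n} - f ` U = {j}" by (auto simp: card_1_singleton_iff)
  have fUj: "f ` U = {..<n} - {j}" using j fU by auto
  show thesis
  proof
    show "j < n" using j by auto
    fix w assume w: "w \<in> carrier_vec n" and Aw: "A *\<^sub>v w = 0\<^sub>v n" and wj: "w $ j = 0"
    have "lincomb (\<lambda>u. w $ f u) U = 0\<^sub>v n"
    proof (rule eq_vecI)
      fix k assume "k < dim_vec (0\<^sub>v n)"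
      then have k: "k < n" by simp
      have "lincomb (\<lambda>u. w $ f u) U $ k = (\<Sum>u\<in>U. w $ f u * u $ k)"
        by (rule lincomb_index[OF k Uc])
      also have "\<dots> = (\<Sum>u\<in>U. A $$ (k, f u) * w $ f u)"
      proof (intro sum.cong refl)
        fix u assume "u \<in> U"
        then have "u $ k = A $$ (k, f u)" using f[of u] A k by (metis carrier_matD index_col)
        then show "w $ f u * u $ k = A $$ (k, f u) * w $ f u" by simp
      qed
      also have "\<dots> = (\<Sum>i\<in>{..<n} - {j}. A $$ (k, i) * w $ i)"
        unfolding fUj[symmetric] by (simp add: sum.reindex[OF inj])
      also have "\<dots> = (\<Sum>i<n. A $$ (k, i) * w $ i)"
        by (rule sum.mono_neutral_left) (auto simp: wj)
      also have "\<dots> = (A *\<^sub>v w) $ k"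
        using A w k by (simp add: scalar_prod_def lessThan_atLeast0)
      finally show "lincomb (\<lambda>u. w $ f u) U $ k = 0\<^sub>v n $ k" by (simp add: Aw)
    qed (use lincomb_dim[OF finU Uc] in simp)
    then have "w $ f u = 0" if "u \<in> U" for u
      using U(2) lin_dep_crit[OF finU subset_refl, where a = "\<lambda>u. w $ f u"] that by auto
    then have "w $ i = 0" if "i < n" for i
    proof -
      have "i = j \<or> i \<in> f ` U" using fUj that by blast
      then show ?thesis using \<open>\<And>u. u \<in> U \<Longrightarrow> w $ f u = 0\<close> wj by auto
    qed
    then show "w = 0\<^sub>v n" using w by (intro eq_vecI) auto
  qed
qed

text \<open>\<open>A * X\<close> and \<open>A * Y\<close> are symmetric projections with the same
  range, hence equal; likewise \<open>X * A = Y * A\<close>. Then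
  \<open>X = X * A * X = Y * A * Y = Y\<close>.\<close>

lemma is_moore_penrose_unique:
  assumes X: "is_moore_penrose A X" and Y: "is_moore_penrose A Y"
  shows "X = Y"
proof -
  define r c where "r = dim_row A" and "c = dim_col A"
  have A: "A \<in> carrier_mat r c" by (auto simp: r_def c_def)
  have Xc: "X \<in> carrier_mat c r" and Yc: "Y \<in> carrier_mat c r"
    using X Y by (auto simp: is_moore_penrose_def r_def c_def)
  note X = X[unfolded is_moore_penrose_def] and Y = Y[unfolded is_moore_penrose_def]
  have AX: "A * X \<in> carrier_mat r r" "A * Y \<in> carrier_mat r r"
    "X * A \<in> carrier_mat c c" "Y * A \<in> carrier_mat c c" using A Xc Yc by auto
  have "A * X = (A * Y) * (A * X)"
    using Y assoc_mult_mat[OF AX(2) A Xc] by simp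
  also have "\<dots> = (A * Y)\<^sup>T * (A * X)\<^sup>T" using X Y by simp
  also have "\<dots> = ((A * X) * (A * Y))\<^sup>T" using transpose_mult[OF AX(1) AX(2)] by simp
  also have "(A * X) * (A * Y) = A * Y"
    using X assoc_mult_mat[OF AX(1) A Yc] by simp
  finally have 1: "A * X = A * Y" using Y by simp
  have "X * A = (X * A) * (Y * A)"
    using Y assoc_mult_mat[OF Xc A AX(4)] assoc_mult_mat[OF A Yc A] by simp
  also have "\<dots> = (X * A)\<^sup>T * (Y * A)\<^sup>T" using X Y by simp
  also have "\<dots> = ((Y * A) * (X * A))\<^sup>T" using transpose_mult[OF AX(4) AX(3)] by simp
  also have "(Y * A) * (X * A) = Y * A"
    using X assoc_mult_mat[OF Yc A AX(3)] assoc_mult_mat[OF A Xc A] by simp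
  finally have 2: "X * A = Y * A" using Y by simp
  have "X = X * A * X" using X by simp
  also have "\<dots> = Y * (A * X)" using 2 A Xc Yc by (simp add: assoc_mult_mat[OF Yc A Xc])
  also have "\<dots> = Y * A * Y" using 1 A Yc by (simp add: assoc_mult_mat[OF Yc A Yc])
  finally show ?thesis using Y by simp
qed

lemma moore_penrose_eqI: "is_moore_penrose A X \<Longrightarrow> moore_penrose A = X"
  unfolding moore_penrose_def using is_moore_penrose_unique by blast

section \<open>Zero-sum matrices of corank one\<close>

text \<open>The condition \<open>n > 0\<close> makes the truncated \<open>n - 1\<close> a genuine
  corank of one.\<close>

locale zero_sum_corank_one =
  fixes S :: "real mat" and n :: nat
  assumes S: "S \<in> carrier_mat n n" and n: "n > 0"
    and rank: "vec_space.rank n S = n - 1"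
    and row_sum: "S *\<^sub>v ones_vec n = 0\<^sub>v n" and col_sum: "S\<^sup>T *\<^sub>v ones_vec n = 0\<^sub>v n"
begin

abbreviation "J \<equiv> ones_mat n"

lemma J: "J \<in> carrier_mat n n" "J\<^sup>T = J"
  by (auto simp: ones_mat_def)

lemma J_mult_entry:
  assumes "A \<in> carrier_mat n n" "i < n" "j < n"
  shows "(J * A) $$ (i, j) = (\<Sum>k<n. A $$ (k, j))" "(A * J) $$ (i, j) = (\<Sum>k<n. A $$ (i, k))"
  using assms by (simp_all add: ones_mat_def scalar_prod_def lessThan_atLeast0)

lemma sum_row: "i < n \<Longrightarrow> (\<Sum>k<n. S $$ (i, k)) = 0"
  using arg_cong[OF row_sum, of "\<lambda>v. v $ i"] S
  by (simp add: ones_vec_def scalar_prod_def lessThan_atLeast0)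

lemma sum_col: "j < n \<Longrightarrow> (\<Sum>k<n. S $$ (k, j)) = 0"
  using arg_cong[OF col_sum, of "\<lambda>v. v $ j"] S
  by (simp add: ones_vec_def scalar_prod_def lessThan_atLeast0)

lemma SJ: "S * J = 0\<^sub>m n n" and JS: "J * S = 0\<^sub>m n n"
  using S J by (auto intro!: eq_matI simp: J_mult_entry sum_row sum_col simp del: index_mult_mat(1))

lemma JJ: "J * J = real n \<cdot>\<^sub>m J"
  using J by (intro eq_matI) (auto simp: ones_mat_def scalar_prod_def)

lemma det_S: "det S = 0"
proof -
  have "ones_vec n $ 0 \<noteq> 0\<^sub>v n $ 0" using n by (simp add: ones_vec_def)
  then have "ones_vec n \<noteq> 0\<^sub>v n" by metis
  moreover have "ones_vec n \<in> carrier_vec n" by (simp add: ones_vec_def)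
  ultimately show ?thesis using det_0_iff_vec_prod_zero_field[OF S] row_sum by blast
qed

text \<open>If \<open>S + J\<close> kills \<open>v\<close>, adding up all coordinates removes the
  \<open>S\<close> part, because columns sum to 0, so the entries of \<open>v\<close> sum to 0 and
  \<open>S\<close> kills \<open>v\<close> too. Corank one makes \<open>v\<close> constant, and a
  constant vector with sum 0 vanishes.\<close>

lemma det_S_plus_J: "det (S + J) \<noteq> 0"
proof
  assume "det (S + J) = 0"
  moreover have SJc: "S + J \<in> carrier_mat n n" using S J by simp
  ultimately obtain v where v: "v \<in> carrier_vec n" "v \<noteq> 0\<^sub>v n" "(S + J) *\<^sub>v v = 0\<^sub>v n"
    using det_0_iff_vec_prod_zero_field by blast
  define s where "s = (\<Sum>k<n. v $ k)"
  have ent: "(\<Sum>k<n. S $$ (i, k) * v $ k) + s = 0" if "i < n" for i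
    using arg_cong[OF v(3), of "\<lambda>v. v $ i"] S v(1) that
    by (simp add: ones_mat_def scalar_prod_def lessThan_atLeast0 distrib_right sum.distrib s_def)
  have "(\<Sum>i<n. (\<Sum>k<n. S $$ (i, k) * v $ k) + s) = 0" using ent by simp
  moreover have "(\<Sum>i<n. \<Sum>k<n. S $$ (i, k) * v $ k) = 0"
    by (subst sum.swap) (simp add: sum_col flip: sum_distrib_right)
  ultimately have s0: "s = 0" using n by (simp add: sum.distrib)
  obtain j where j: "j < n"
    "\<And>w. w \<in> carrier_vec n \<Longrightarrow> S *\<^sub>v w = 0\<^sub>v n \<Longrightarrow> w $ j = 0 \<Longrightarrow> w = 0\<^sub>v n"
    using vec_space.kernel_zero_if_corank_one[OF S rank n] by blast
  \<comment> \<open>Subtracting a multiple of the ones vector stays in the kernel of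
    \<open>S\<close> and makes coordinate \<open>j\<close> zero.\<close>
  define w where "w = vec n (\<lambda>i. v $ i - v $ j)"
  have "S *\<^sub>v w = 0\<^sub>v n"
  proof (rule eq_vecI)
    fix i assume "i < dim_vec (0\<^sub>v n)"
    then have i: "i < n" by simp
    have "(S *\<^sub>v w) $ i = (\<Sum>k<n. S $$ (i, k) * v $ k) - (\<Sum>k<n. S $$ (i, k)) * v $ j"
      using i S by (simp add: w_def scalar_prod_def lessThan_atLeast0 right_diff_distrib sum_subtractf sum_distrib_right)
    then show "(S *\<^sub>v w) $ i = 0\<^sub>v n $ i" using ent[OF i] s0 sum_row[OF i] i by simp
  qed (use S in auto)
  then have "w = 0\<^sub>v n" using j by (simp add: w_def)
  then have vj: "v $ i = v $ j" if "i < n" for i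
  proof -
    have "w $ i = 0" using \<open>w = 0\<^sub>v n\<close> that by simp
    then show ?thesis using that by (simp add: w_def)
  qed
  then have "s = real n * v $ j" unfolding s_def by simp
  then have "v $ j = 0" using s0 n by simp
  then have "v = 0\<^sub>v n" using vj v(1) by (intro eq_vecI) auto
  then show False using v(2) by simp
qed

text \<open>The inverse \<open>N\<close> of \<open>S + J\<close> differs from the Moore-Penrose
  inverse by a multiple of \<open>J\<close>. The corrected matrix is checked against the four
  defining equations and identified by uniqueness.\<close>

lemma moore_penrose_props:
  defines "X \<equiv> moore_penrose S"
  shows "X \<in> carrier_mat n n" "S * X = 1\<^sub>m n - (1 / real n) \<cdot>\<^sub>m J" "X * S = 1\<^sub>m n - (1 / real n) \<cdot>\<^sub>m J"
    "J * X = 0\<^sub>m n n"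
proof -
  have Mc: "S + J \<in> carrier_mat n n" using S J by simp
  obtain N where N: "N \<in> carrier_mat n n" "(S + J) * N = 1\<^sub>m n" "N * (S + J) = 1\<^sub>m n"
    using det_non_zero_imp_unit[OF Mc det_S_plus_J, of "()"]
    by (auto simp: Units_def ring_mat_simps)
  have add_eq_imp: "A = C - B" if "A \<in> carrier_mat n n" "B \<in> carrier_mat n n" "A + B = C" for A B C :: "real mat"
    using that by (intro eq_matI) auto
  have smult_n_cancel: "(1 / real n) \<cdot>\<^sub>m (real n \<cdot>\<^sub>m A) = A" for A
    using n by (intro eq_matI) auto
  \<comment> \<open>Since \<open>J * (S + J) = n J\<close>, cancelling \<open>N\<close> against
    \<open>S + J\<close> shows that \<open>N\<close> acts on \<open>J\<close> from either side as
    the scalar \<open>1 / n\<close>.\<close>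
  have "(J * (S + J)) * N = J" "N * ((S + J) * J) = J"
    using assoc_mult_mat[OF J(1) Mc N(1)] assoc_mult_mat[OF N(1) Mc J(1)] N(2,3) J(1) by simp_all
  moreover have "J * (S + J) = real n \<cdot>\<^sub>m J" "(S + J) * J = real n \<cdot>\<^sub>m J"
    using mult_add_distrib_mat[OF J(1) S J(1)] add_mult_distrib_mat[OF S J(1) J(1)] J(1)
    by (simp_all add: JS SJ JJ)
  ultimately have "real n \<cdot>\<^sub>m (J * N) = J" "real n \<cdot>\<^sub>m (N * J) = J"
    using mult_smult_assoc_mat[OF J(1) N(1)] mult_smult_distrib[OF N(1) J(1)] by simp_all
  then have JN: "J * N = (1 / real n) \<cdot>\<^sub>m J" and NJ: "N * J = (1 / real n) \<cdot>\<^sub>m J"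
    using smult_n_cancel[of "J * N"] smult_n_cancel[of "N * J"] by simp_all
  \<comment> \<open>The coefficient is forced by \<open>J * Y = 0\<close>, as
    \<open>J * N = J / n\<close> and \<open>J * J = n J\<close>. The products with \<open>S\<close>
    do not change, because \<open>S * J\<close> and \<open>J * S\<close> vanish.\<close>
  define Y where "Y = N - (1 / (real n)\<^sup>2) \<cdot>\<^sub>m J"
  have Y: "Y \<in> carrier_mat n n" unfolding Y_def by (rule minus_carrier_mat) (use J in simp)
  have cJ: "c \<cdot>\<^sub>m J \<in> carrier_mat n n" for c using J by simp
  have "S * N + J * N = 1\<^sub>m n" "N * S + N * J = 1\<^sub>m n"
    using add_mult_distrib_mat[OF S J(1) N(1)] mult_add_distrib_mat[OF N(1) S J(1)] N(2,3) by simp_all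
  then have SN: "S * N = 1\<^sub>m n - (1 / real n) \<cdot>\<^sub>m J" and NS: "N * S = 1\<^sub>m n - (1 / real n) \<cdot>\<^sub>m J"
    using add_eq_imp[of "S * N" "J * N"] add_eq_imp[of "N * S" "N * J"] S J N(1) JN NJ by simp_all
  have diff_zero: "A - 0\<^sub>m n n = A" if "A \<in> carrier_mat n n" for A :: "real mat"
    using that by (intro eq_matI) auto
  have SY: "S * Y = 1\<^sub>m n - (1 / real n) \<cdot>\<^sub>m J"
  proof -
    have "S * Y = S * N - S * ((1 / (real n)\<^sup>2) \<cdot>\<^sub>m J)"
      unfolding Y_def by (rule mult_minus_distrib_mat[OF S N(1) cJ])
    then show ?thesis
      using SN S J N by (simp add: mult_smult_distrib[OF S J(1)] SJ diff_zero minus_carrier_mat)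
  qed
  have YS: "Y * S = 1\<^sub>m n - (1 / real n) \<cdot>\<^sub>m J"
  proof -
    have "Y * S = N * S - ((1 / (real n)\<^sup>2) \<cdot>\<^sub>m J) * S"
      unfolding Y_def by (rule minus_mult_distrib_mat[OF N(1) cJ S])
    then show ?thesis
      using NS S J N by (simp add: mult_smult_assoc_mat[OF J(1) S] JS diff_zero minus_carrier_mat)
  qed
  have cancel: "(1 / real n) \<cdot>\<^sub>m J - (1 / (real n)\<^sup>2) \<cdot>\<^sub>m (real n \<cdot>\<^sub>m J) = 0\<^sub>m n n"
    using J n by (intro eq_matI) (auto simp: power2_eq_square)
  have JY: "J * Y = 0\<^sub>m n n"
  proof -
    have "J * Y = J * N - J * ((1 / (real n)\<^sup>2) \<cdot>\<^sub>m J)"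
      unfolding Y_def by (rule mult_minus_distrib_mat[OF J(1) N(1) cJ])
    then show ?thesis using cancel by (simp add: mult_smult_distrib[OF J(1) J(1)] JN JJ)
  qed
  have "is_moore_penrose S Y"
  proof -
    have "S * Y * S = 1\<^sub>m n * S - ((1 / real n) \<cdot>\<^sub>m J) * S"
      unfolding SY by (rule minus_mult_distrib_mat[OF one_carrier_mat cJ S])
    then have "S * Y * S = S"
      using S by (simp add: mult_smult_assoc_mat[OF J(1) S] JS diff_zero)
    moreover have "Y * S * Y = 1\<^sub>m n * Y - ((1 / real n) \<cdot>\<^sub>m J) * Y"
      unfolding YS by (rule minus_mult_distrib_mat[OF one_carrier_mat cJ Y])
    then have "Y * S * Y = Y"
      using Y by (simp add: mult_smult_assoc_mat[OF J(1) Y] JY diff_zero)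
    moreover have "(1\<^sub>m n - (1 / real n) \<cdot>\<^sub>m J)\<^sup>T = 1\<^sub>m n - (1 / real n) \<cdot>\<^sub>m J"
      by (intro eq_matI) (auto simp: ones_mat_def)
    ultimately show ?thesis
      unfolding is_moore_penrose_def using S Y by (simp add: SY YS)
  qed
  then have "X = Y" unfolding X_def by (rule moore_penrose_eqI)
  then show "X \<in> carrier_mat n n" "S * X = 1\<^sub>m n - (1 / real n) \<cdot>\<^sub>m J" "X * S = 1\<^sub>m n - (1 / real n) \<cdot>\<^sub>m J"
    "J * X = 0\<^sub>m n n"
    using Y SY YS JY by simp_all
qed

text \<open>As \<open>det S = 0\<close>, the adjugate is annihilated by \<open>S\<close> on both
  sides, hence by the projection \<open>1 - J / n\<close>, which is both \<open>X * S\<close> and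
  \<open>S * X\<close>. Each entry therefore equals the mean of its column and the mean of its row,
  which makes all entries equal.\<close>

lemma cofactor_const:
  assumes "i < n" "j < n"
  shows "cofactor S i j = cofactor S 0 0"
proof -
  define X where "X = moore_penrose S"
  note X = moore_penrose_props[folded X_def]
  let ?B = "adj_mat S"
  have B: "?B \<in> carrier_mat n n" "S * ?B = 0\<^sub>m n n" "?B * S = 0\<^sub>m n n"
    using adj_mat[OF S] det_S by (auto intro!: eq_matI)
  have cJ: "(1 / real n) \<cdot>\<^sub>m J \<in> carrier_mat n n" using J by simp
  have "?B - (1 / real n) \<cdot>\<^sub>m (J * ?B) = (X * S) * ?B"
    unfolding X(3) using minus_mult_distrib_mat[OF one_carrier_mat cJ B(1)] B(1)
    by (simp add: mult_smult_assoc_mat[OF J(1) B(1)])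
  also have "\<dots> = 0\<^sub>m n n" using assoc_mult_mat[OF X(1) S B(1)] X(1) B(2) by simp
  finally have left: "?B - (1 / real n) \<cdot>\<^sub>m (J * ?B) = 0\<^sub>m n n" .
  have "?B - (1 / real n) \<cdot>\<^sub>m (?B * J) = ?B * (S * X)"
    unfolding X(2) using mult_minus_distrib_mat[OF B(1) one_carrier_mat cJ] B(1)
    by (simp add: mult_smult_distrib[OF B(1) J(1)])
  also have "\<dots> = 0\<^sub>m n n" using assoc_mult_mat[OF B(1) S X(1)] X(1) B(3) by simp
  finally have right: "?B - (1 / real n) \<cdot>\<^sub>m (?B * J) = 0\<^sub>m n n" .
  have entry: "?B $$ (a, b) = (1 / real n) * (\<Sum>k<n. ?B $$ (k, b))"
    "?B $$ (a, b) = (1 / real n) * (\<Sum>k<n. ?B $$ (a, k))" if "a < n" "b < n" for a b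
    using arg_cong[OF left, of "\<lambda>M. M $$ (a, b)"] arg_cong[OF right, of "\<lambda>M. M $$ (a, b)"]
      that B(1) J(1) J_mult_entry[OF B(1) that]
    by (simp_all del: index_mult_mat(1))
  have "?B $$ (j, i) = ?B $$ (0, i)" using entry(1)[of j i] entry(1)[of 0 i] assms n by simp
  also have "\<dots> = ?B $$ (0, 0)" using entry(2)[of 0 i] entry(2)[of 0 0] assms n by simp
  finally show ?thesis using S assms n by (simp add: adj_mat_def)
qed

lemma common_cofactor_eq:
  assumes "i < n" "j < n"
  shows "cofactor S i j = common_cofactor S"
proof -
  have "common_cofactor S = cofactor S 0 0"
    unfolding common_cofactor_def
  proof (rule the_equality)
    show "\<forall>i<dim_row S. \<forall>j<dim_col S. cofactor S i j = cofactor S 0 0"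
      using S by (intro allI impI cofactor_const) auto
  qed (use S n in auto)
  then show ?thesis using cofactor_const[OF assms] by simp
qed

lemma cofsum_S: "cofsum S = (real n)\<^sup>2 * common_cofactor S"
  by (simp add: cofsum_eq_sum_cofactor[OF S] common_cofactor_eq power2_eq_square)

text \<open>The cross terms contain \<open>S * J\<close> or \<open>J * moore_penrose S\<close> and
  vanish. The remaining term \<open>t c n J\<close> equals \<open>J / n\<close>, which is what
  \<open>S * moore_penrose S\<close> lacks to be the identity.\<close>

lemma perturbed_inverse:
  assumes "t * c * (real n)\<^sup>2 = 1"
  shows "(S + t \<cdot>\<^sub>m J) * (moore_penrose S + c \<cdot>\<^sub>m J) = 1\<^sub>m n"
proof -
  define X where "X = moore_penrose S"
  note X = moore_penrose_props[folded X_def]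
  have cJ: "a \<cdot>\<^sub>m J \<in> carrier_mat n n" for a using J by simp
  have "(S + t \<cdot>\<^sub>m J) * (X + c \<cdot>\<^sub>m J) = S * X + S * (c \<cdot>\<^sub>m J) + ((t \<cdot>\<^sub>m J) * X + (t \<cdot>\<^sub>m J) * (c \<cdot>\<^sub>m J))"
    using add_mult_distrib_mat[OF S cJ add_carrier_mat[OF cJ]] mult_add_distrib_mat[OF S X(1) cJ]
      mult_add_distrib_mat[OF cJ X(1) cJ] by simp
  also have "\<dots> = (1\<^sub>m n - (1 / real n) \<cdot>\<^sub>m J) + c \<cdot>\<^sub>m 0\<^sub>m n n + (t \<cdot>\<^sub>m 0\<^sub>m n n + t \<cdot>\<^sub>m (c \<cdot>\<^sub>m (real n \<cdot>\<^sub>m J)))"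
    by (simp add: X(2) mult_smult_distrib[OF S J(1)] mult_smult_assoc_mat[OF J(1) X(1)]
        mult_smult_assoc_mat[OF J(1) cJ] mult_smult_distrib[OF J(1) J(1)] SJ X(4) JJ)
  also have "\<dots> = 1\<^sub>m n"
    using assms n by (intro eq_matI) (auto simp: ones_mat_def field_simps power2_eq_square)
  finally show ?thesis unfolding X_def .
qed

text \<open>This is the theorem's identity for \<open>S\<close> in place of \<open>D\<close>, with
  0-based index sets, so without the factor coming from the scalar -2.\<close>

lemma cofsum_select_mat:
  assumes I: "I \<subseteq> {..<n}" and K: "K \<subseteq> {..<n}" and card: "card I = card K"
  shows "cofsum (select_mat S (sorted_list_of_set I) (sorted_list_of_set K)) =
    (-1) ^ (\<Sum>I + \<Sum>K) * (real n)\<^sup>2 * common_cofactor S *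
    det (select_mat (moore_penrose S) (sorted_list_of_set ({..<n} - K)) (sorted_list_of_set ({..<n} - I)))"
proof -
  define X where "X = moore_penrose S"
  note X = moore_penrose_props[folded X_def]
  let ?x = "sorted_list_of_set I" and ?y = "sorted_list_of_set K"
  let ?x' = "sorted_list_of_set ({..<n} - I)" and ?y' = "sorted_list_of_set ({..<n} - K)"
  define \<sigma> :: real where "\<sigma> = (-1) ^ (\<Sum>I + \<Sum>K)"
  have fin: "finite I" "finite K" using I K finite_subset by blast+
  have sets: "set ?x \<subseteq> {..<n}" "set ?y \<subseteq> {..<n}" "set ?x' \<subseteq> {..<n}" "set ?y' \<subseteq> {..<n}"
    using fin I K by auto
  have len: "length ?y = length ?x" "length ?x' = length ?y'"
    using fin I K card by (auto simp: card_Diff_subset)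
  have det_sel: "det (select_mat (A + a \<cdot>\<^sub>m J) p q) = det (select_mat A p q) + a * cofsum (select_mat A p q)"
    if "A \<in> carrier_mat n n" "set p \<subseteq> {..<n}" "set q \<subseteq> {..<n}" "length q = length p" for A a p q
  proof -
    have "select_mat (A + a \<cdot>\<^sub>m J) p q =
        mat (length p) (length p) (\<lambda>(i, j). select_mat A p q $$ (i, j) + a)"
      using that nth_less_if_set_subset[of p n] nth_less_if_set_subset[of q n]
      by (intro eq_matI) (auto simp: select_mat_def ones_mat_def)
    moreover have "select_mat A p q \<in> carrier_mat (length p) (length p)"
      using that(4) by (auto simp: select_mat_def)
    ultimately show ?thesis using det_add_const by simp
  qed
  let ?cS = "cofsum (select_mat S ?x ?y)" and ?dS = "det (select_mat S ?x ?y)"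
  let ?cX = "cofsum (select_mat X ?y' ?x')" and ?dX = "det (select_mat X ?y' ?x')"
  have key: "?dS + t * ?cS = \<sigma> * ((real n)\<^sup>2 * common_cofactor S * t * ?dX + common_cofactor S * ?cX)"
    if "t \<noteq> 0" for t
  proof -
    define c where "c = 1 / (t * (real n)\<^sup>2)"
    have c: "t * c * (real n)\<^sup>2 = 1" using n that by (simp add: c_def)
    have M: "S + t \<cdot>\<^sub>m J \<in> carrier_mat n n" "X + c \<cdot>\<^sub>m J \<in> carrier_mat n n" using S X J by auto
    have "S + t \<cdot>\<^sub>m J = mat n n (\<lambda>(i, j). S $$ (i, j) + t)"
      using S by (intro eq_matI) (auto simp: ones_mat_def)
    then have detM: "det (S + t \<cdot>\<^sub>m J) = t * ((real n)\<^sup>2 * common_cofactor S)"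
      using det_add_const[OF S, of t] by (simp add: det_S cofsum_S)
    have "?dS + t * ?cS = det (select_mat (S + t \<cdot>\<^sub>m J) ?x ?y)"
      using det_sel[OF S] sets len by simp
    also have "\<dots> = \<sigma> * det (S + t \<cdot>\<^sub>m J) * det (select_mat (X + c \<cdot>\<^sub>m J) ?y' ?x')"
      unfolding \<sigma>_def
      by (rule jacobi_complementary_minor[OF M _ I K card]) (use perturbed_inverse[OF c] in \<open>simp add: X_def\<close>)
    also have "\<dots> = \<sigma> * (t * ((real n)\<^sup>2 * common_cofactor S)) * (?dX + c * ?cX)"
      using det_sel[OF X(1)] sets len by (simp add: detM)
    \<comment> \<open>The factor \<open>t\<close> in \<open>det (S + t J)\<close> absorbs the
      denominator of \<open>c\<close>, so the right side is affine in \<open>t\<close> and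
      \<open>?cX\<close> enters only the constant term.\<close>
    also have "\<dots> = \<sigma> * ((real n)\<^sup>2 * common_cofactor S * t * ?dX + (t * c * (real n)\<^sup>2) * common_cofactor S * ?cX)"
      by (simp add: algebra_simps)
    finally show ?thesis by (simp add: c)
  qed
  \<comment> \<open>Subtracting the instances \<open>t = 1\<close> and \<open>t = 2\<close> isolates
    the slopes.\<close>
  from key[of 1] key[of 2] have "?cS = \<sigma> * (real n)\<^sup>2 * common_cofactor S * ?dX"
    by (simp add: algebra_simps)
  then show ?thesis unfolding \<sigma>_def X_def .
qed
end

section \<open>Passage from \<open>S\<close> to \<open>D\<close> and to 1-based index sets\<close>

lemma shift_index_set:
  assumes "\<Omega> \<subseteq> {1..n}"
  shows "{i. Suc i \<in> \<Omega>} \<subseteq> {..<n}" "\<Omega> = Suc ` {i. Suc i \<in> \<Omega>}"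
proof -
  show "{i. Suc i \<in> \<Omega>} \<subseteq> {..<n}" using assms by fastforce
  show "\<Omega> = Suc ` {i. Suc i \<in> \<Omega>}"
  proof
    show "\<Omega> \<subseteq> Suc ` {i. Suc i \<in> \<Omega>}"
    proof
      fix k assume k: "k \<in> \<Omega>"
      then have "k = Suc (k - 1)" using assms by fastforce
      with k show "k \<in> Suc ` {i. Suc i \<in> \<Omega>}" by (metis imageI mem_Collect_eq)
    qed
  qed auto
qed

theorem theorem5p4:
  fixes S D :: "real mat" and n \<eta> :: nat and \<gamma> :: real and \<Omega>1 \<Omega>2 :: "nat set"
  assumes "S \<in> carrier_mat n n"
    and "vec_space.rank n S = n - 1"
    and "S *\<^sub>v ones_vec n = 0\<^sub>v n"
    and "S\<^sup>T *\<^sub>v ones_vec n = 0\<^sub>v n"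
    and "\<gamma> = common_cofactor S"
    and "D = diag_part S * ones_mat n + ones_mat n * diag_part S - 2 \<cdot>\<^sub>m S"
    and "\<Omega>1 \<subseteq> {1..n}" and "\<Omega>2 \<subseteq> {1..n}"
    and "\<Omega>1 \<noteq> {}" and "\<Omega>2 \<noteq> {}"
    and "\<eta> = card \<Omega>1" and "\<eta> = card \<Omega>2"
  shows "cofsum (submat D \<Omega>1 \<Omega>2) =
    (-1) ^ (index_sum \<Omega>1 + index_sum \<Omega>2 + \<eta> - 1) * 2 ^ (\<eta> - 1) * (real n)\<^sup>2 * \<gamma> *
    det (submat (moore_penrose S) ({1..n} - \<Omega>2) ({1..n} - \<Omega>1))"
proof -
  have n: "n > 0" using assms(7,9) by (cases n) auto
  interpret zero_sum_corank_one S n using assms(1-4) n by unfold_locales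
  define I K where "I = {i. Suc i \<in> \<Omega>1}" and "K = {i. Suc i \<in> \<Omega>2}"
  let ?x = "sorted_list_of_set I" and ?y = "sorted_list_of_set K"
  have I: "I \<subseteq> {..<n}" "\<Omega>1 = Suc ` I" and K: "K \<subseteq> {..<n}" "\<Omega>2 = Suc ` K"
    using shift_index_set[OF assms(7)] shift_index_set[OF assms(8)] by (simp_all add: I_def K_def)
  have cardI: "card I = \<eta>" and cardK: "card K = \<eta>"
    using assms(11,12) I(2) K(2) by (simp_all add: card_image)
  have fin: "finite I" "finite K" using I(1) K(1) finite_subset by blast+
  have \<eta>: "\<eta> > 0" using assms(9) I(2) cardI fin by (simp add: card_gt_0_iff flip: cardI)
  have compl: "{i. Suc i \<in> {1..n} - \<Omega>1} = {..<n} - I" "{i. Suc i \<in> {1..n} - \<Omega>2} = {..<n} - K"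
    by (auto simp: I_def K_def)
  have sum: "index_sum \<Omega>1 = \<Sum>I + \<eta>" "index_sum \<Omega>2 = \<Sum>K + \<eta>"
    using cardI cardK by (simp_all add: index_sum_def I(2) K(2) sum.reindex sum_Suc)
  \<comment> \<open>Shifting both index sets adds \<open>2 * \<eta>\<close> to the exponent, which
    is even; \<open>\<eta> > 0\<close> keeps the truncated \<open>\<eta> - 1\<close> exact.\<close>
  have sign: "(-1 :: real) ^ (index_sum \<Omega>1 + index_sum \<Omega>2 + \<eta> - 1) = (-1) ^ (\<eta> - 1) * (-1) ^ (\<Sum>I + \<Sum>K)"
    using \<eta> by (auto simp: sum minus_one_power_iff)
  have D: "D \<in> carrier_mat n n" using assms(6) S by auto
  \<comment> \<open>Up to the factor -2, \<open>D\<close> differs from \<open>S\<close> by a term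
    depending on the row only and one depending on the column only.\<close>
  have entryD: "D $$ (i, j) = (-2) * S $$ (i, j) + S $$ (i, i) + S $$ (j, j)" if "i < n" "j < n" for i j
    using that S by (simp add: assms(6) diag_part_def ones_mat_def mat_diag_mult_left[of _ n n] mat_diag_mult_right[of _ n n])
  define B where "B = select_mat S ?x ?y"
  have B: "B \<in> carrier_mat \<eta> \<eta>" using cardI cardK by (auto simp: B_def select_mat_def)
  \<comment> \<open>\<open>C\<close> keeps the row term but not the column term, so the two
    invariances of \<open>cofsum\<close> can be applied in turn.\<close>
  define C where "C = mat \<eta> \<eta> (\<lambda>(i, j). ((-2) \<cdot>\<^sub>m B) $$ (i, j) + S $$ (?x ! i, ?x ! i))"
  have C: "C \<in> carrier_mat \<eta> \<eta>" by (simp add: C_def)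
  have xy: "?x ! i < n" "?y ! i < n" if "i < \<eta>" for i
    using nth_less_if_set_subset[of ?x n i] nth_less_if_set_subset[of ?y n i] fin I(1) K(1) cardI cardK that
    by simp_all
  have "submat D \<Omega>1 \<Omega>2 = select_mat D ?x ?y"
    unfolding submat_def I_def[symmetric] K_def[symmetric] by (rule submatrix_eq_select_mat[OF D I(1) K(1)])
  also have "\<dots> = mat \<eta> \<eta> (\<lambda>(i, j). C $$ (i, j) + S $$ (?y ! j, ?y ! j))"
    using cardI cardK B xy
    by (intro eq_matI) (auto simp: C_def B_def select_mat_def entryD)
  finally have "cofsum (submat D \<Omega>1 \<Omega>2) = cofsum C" using cofsum_add_col_const[OF C] by simp
  also have "\<dots> = cofsum ((-2) \<cdot>\<^sub>m B)" unfolding C_def using B by (intro cofsum_add_row_const) simp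
  also have "\<dots> = (-2) ^ (\<eta> - 1) * cofsum B" by (rule cofsum_smult[OF B])
  also have "cofsum B = (-1) ^ (\<Sum>I + \<Sum>K) * (real n)\<^sup>2 * \<gamma> *
      det (submat (moore_penrose S) ({1..n} - \<Omega>2) ({1..n} - \<Omega>1))"
    unfolding B_def submat_def compl assms(5)
    using cofsum_select_mat[OF I(1) K(1)] cardI cardK
      submatrix_eq_select_mat[OF moore_penrose_props(1), of "{..<n} - K" "{..<n} - I"] by simp
  also have "(-2 :: real) ^ (\<eta> - 1) = (-1) ^ (\<eta> - 1) * 2 ^ (\<eta> - 1)"
    by (simp flip: power_mult_distrib)
  finally show ?thesis unfolding sign by simp
qed

end
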